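(* Let $k \geq 2$ be an integer, put $a = -6k-3$, and let $$P(x) = x^6 + a x^5 - 2a x^4 + (2a-3) x^3 - 2a x^2 + a x + 1.$$ Then $P(x)$ is a Salem polynomial, and if $\beta > 1$ is the Salem number with minimal polynomial $P(x)$, then the greedy beta expansion $d_\beta(1)$ of $1$ is eventually periodic with preperiod length $m = 1$ and period length $p = 8k+6$.
   Context: A Salem number is a real algebraic integer $\beta>1$ whose other Galois conjugates all satisfy $|\alpha|\le 1$, with at least one satisfying $|\alpha|=1$. A Salem polynomial is the minimal polynomial of a Salem number. For real $\beta>1$, the greedy beta expansion $d_\beta(1)=(c_n)_{n\ge1}$ is defined by $r_0=1$, and for $n\ge 1$: $c_n=\lfloor \beta r_{n-1}\rfloor$, $r_n=\beta r_{n-1}-\lfloor \beta r_{n-1}\rfloor$. It is eventually periodic if there are $m\ge 0$, $p\ge 1$ with $c_{n+m}=c_{n+m+p}$ for all $n\ge1$; the smallest such $m\geq 0$ and $p\geq 1$ are called the preperiod length and the period length, respectively. (By convention $p=0$ if $r_N=0$ for some $N$; this never happens for Salem numbers.) *)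

theory Defs
  imports Complex_Main "HOL-Computational_Algebra.Computational_Algebra"
begin

definition is_minimal_poly :: "rat poly \<Rightarrow> 'a::field_char_0 \<Rightarrow> bool" where
  "is_minimal_poly p x \<longleftrightarrow>
     lead_coeff p = 1 \<and> poly (map_poly of_rat p) x = 0 \<and>
     (\<forall>q. q \<noteq> 0 \<longrightarrow> poly (map_poly of_rat q) x = 0 \<longrightarrow> degree p \<le> degree q)"

definition galois_conjugates :: "real \<Rightarrow> complex set" where
  "galois_conjugates x =
     {z. \<exists>p. is_minimal_poly p x \<and> poly (map_poly of_rat p) z = 0}"

definition salem_number :: "real \<Rightarrow> bool" where
  "salem_number \<beta> \<longleftrightarrow> \<beta> > 1 \<and> algebraic_int \<beta> \<and>
     (\<forall>\<alpha> \<in> galois_conjugates \<beta> - {of_real \<beta>}. norm \<alpha> \<le> 1) \<and>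
     (\<exists>\<alpha> \<in> galois_conjugates \<beta> - {of_real \<beta>}. norm \<alpha> = 1)"

definition salem_poly :: "int poly \<Rightarrow> bool" where
  "salem_poly P \<longleftrightarrow> (\<exists>\<beta>. salem_number \<beta> \<and> is_minimal_poly (map_poly of_int P) \<beta>)"

primrec greedy_remainder :: "real \<Rightarrow> nat \<Rightarrow> real" where
  "greedy_remainder \<beta> 0 = 1"
| "greedy_remainder \<beta> (Suc n) =
     \<beta> * greedy_remainder \<beta> n - of_int \<lfloor>\<beta> * greedy_remainder \<beta> n\<rfloor>"

(* Digits are numbered from 1; the value at index 0 carries no meaning and
   is never inspected by the definitions below. *)
definition greedy_digit :: "real \<Rightarrow> nat \<Rightarrow> int" where
  "greedy_digit \<beta> n = \<lfloor>\<beta> * greedy_remainder \<beta> (n - 1)\<rfloor>"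

definition periodic_from :: "(nat \<Rightarrow> 'a) \<Rightarrow> nat \<Rightarrow> nat \<Rightarrow> bool" where
  "periodic_from c m p \<longleftrightarrow> p \<ge> 1 \<and> (\<forall>n\<ge>1. c (n + m) = c (n + m + p))"

definition eventually_periodic :: "(nat \<Rightarrow> 'a) \<Rightarrow> bool" where
  "eventually_periodic c \<longleftrightarrow> (\<exists>m p. periodic_from c m p)"

(* The two lengths below are meaningful only for eventually periodic expansions. *)
definition preperiod_length :: "real \<Rightarrow> nat" where
  "preperiod_length \<beta> = (LEAST m. \<exists>p. periodic_from (greedy_digit \<beta>) m p)"

(* A finite expansion (some remainder vanishes) has period length 0 by convention. *)
definition period_length :: "real \<Rightarrow> nat" where
  "period_length \<beta> =
     (if \<exists>N. greedy_remainder \<beta> N = 0 then 0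
      else (LEAST p. periodic_from (greedy_digit \<beta>) (preperiod_length \<beta>) p))"

end

theory Submission
  imports Defs
begin

text \<open>Since \<open>P(x) = x\<^sup>3 Q(x + 1/x)\<close> with a cubic \<open>Q\<close> that is irreducible (of Eisenstein type at 3) and has
  two zeros in \<open>(0, 2)\<close> and one beyond 2, the zeros of \<open>P\<close> are \<open>\<beta>\<close>, \<open>1/\<beta>\<close> and four points of the unit
  circle. If \<open>P\<close> were not minimal, \<open>\<beta>\<close> would lie in the cubic field of \<open>\<beta> + 1/\<beta>\<close>, and applying the
  embedding into the reals that sends \<open>\<beta> + 1/\<beta>\<close> to a zero \<open>t\<close> of \<open>Q\<close> in \<open>(-2, 2)\<close> would give a real
  solution of \<open>x\<^sup>2 - t x + 1 = 0\<close>.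

  For the expansion one writes down the digits explicitly: after the first digit \<open>6 k\<close> they cycle through a word of
  length \<open>8 k + 6\<close> made of blocks \<open>6 j, 6 j, 6 j, 6 j + 3\<close> with \<open>j\<close> increasing, a short middle part, and blocks
  \<open>6 j, 6 j, 6 j, 6 j - 3\<close> with \<open>j\<close> decreasing. That the remainder returns to \<open>\<beta> - 6 k\<close> is an algebraic
  identity modulo \<open>P(\<beta>) = 0\<close>; that all remainders lie in \<open>(0, 1)\<close> follows backwards from the end of the
  word, because all but two digits of the word are less than \<open>6 k < \<beta>\<close>. The positions of these two digits
  exclude shorter preperiods and periods.\<close>

section \<open>Irreducibility and conjugates\<close>

lemma poly_of_rat_add:
  "poly (map_poly of_rat (p + q)) (x::'a::field_char_0) =
     poly (map_poly of_rat p) x + poly (map_poly of_rat q) x"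
proof -
  have "map_poly (of_rat :: rat \<Rightarrow> 'a) (p + q) = map_poly of_rat p + map_poly of_rat q"
    by (intro poly_eqI) (simp add: coeff_map_poly of_rat_add)
  then show ?thesis by simp
qed

lemma poly_of_rat_diff:
  "poly (map_poly of_rat (p - q)) (x::'a::field_char_0) =
     poly (map_poly of_rat p) x - poly (map_poly of_rat q) x"
proof -
  have "map_poly (of_rat :: rat \<Rightarrow> 'a) (p - q) = map_poly of_rat p - map_poly of_rat q"
    by (intro poly_eqI) (simp add: coeff_map_poly of_rat_diff)
  then show ?thesis by simp
qed

lemma poly_of_rat_pCons:
  "poly (map_poly of_rat (pCons c p)) (x::'a::field_char_0) =
     of_rat c + x * poly (map_poly of_rat p) x"
  by (simp add: map_poly_pCons)

lemma poly_of_rat_smult: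
  "poly (map_poly of_rat (smult c p)) (x::'a::field_char_0) =
     of_rat c * poly (map_poly of_rat p) x"
  by (simp add: map_poly_smult of_rat_mult)

lemma poly_of_rat_mult:
  "poly (map_poly of_rat (p * q)) (x::'a::field_char_0) =
     poly (map_poly of_rat p) x * poly (map_poly of_rat q) x"
  by (induction p)
    (simp_all add: poly_of_rat_add poly_of_rat_smult poly_of_rat_pCons algebra_simps)

lemmas poly_of_rat = poly_of_rat_add poly_of_rat_mult poly_of_rat_pCons

text \<open>Division with remainder shows that a nonzero polynomial \<open>g\<close> of least degree
  vanishing at \<open>x\<close> divides every polynomial vanishing at \<open>x\<close>. Since
  \<open>p\<close> is irreducible, it is an associate of \<open>g\<close>.\<close>

lemma irreducible_dvd_of_common_root:
  fixes p q :: "rat poly" and x :: "'a::field_char_0"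
  assumes "irreducible p" "poly (map_poly of_rat p) x = 0" "poly (map_poly of_rat q) x = 0"
  shows "p dvd q"
proof -
  let ?root = "\<lambda>g. poly (map_poly of_rat g) x = 0"
  have "p \<noteq> 0" using assms(1) by (auto simp: irreducible_def)
  then obtain g where g: "g \<noteq> 0" "?root g"
    and least: "\<And>h. h \<noteq> 0 \<Longrightarrow> ?root h \<Longrightarrow> degree g \<le> degree h"
    using ex_has_least_nat[of "\<lambda>h. h \<noteq> 0 \<and> ?root h" p degree] assms(2) by metis
  have dvd: "g dvd h" if "?root h" for h
  proof (rule ccontr)
    assume "\<not> g dvd h"
    then have nz: "h mod g \<noteq> 0" by (simp add: dvd_eq_mod_eq_0)
    have "h mod g = h - h div g * g" by (rule minus_div_mult_eq_mod [symmetric])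
    then have "?root (h mod g)"
      using that g(2) by (simp add: poly_of_rat_diff poly_of_rat_mult)
    then have "degree g \<le> degree (h mod g)" using least nz by blast
    with degree_mod_less'[OF g(1) nz] show False by simp
  qed
  obtain h where h: "p = g * h" using dvd[OF assms(2)] by (elim dvdE)
  have "\<not> g dvd 1"
  proof
    assume "g dvd 1"
    with g(1) have "degree g = 0" by (simp add: is_unit_iff_degree)
    then obtain c where "g = [:c:]" by (rule degree_eq_zeroE)
    with g show False by (simp add: map_poly_pCons)
  qed
  with irreducibleD[OF assms(1) h] have "h dvd 1" by blast
  then have "p dvd g" using h by (simp add: mult_unit_dvd_iff)
  with dvd[OF assms(3)] show ?thesis by (rule dvd_trans[rotated])
qed

text \<open>A proper factorization of a cubic contains a linear factor, which has a rational
  zero.\<close>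

lemma irreducible_cubic:
  fixes p :: "rat poly"
  assumes "degree p = 3" and no_root: "\<And>r. poly p r \<noteq> 0"
  shows "irreducible p"
proof (rule irreducibleI)
  show "p \<noteq> 0" using assms by auto
  show "\<not> p dvd 1" using \<open>p \<noteq> 0\<close> assms(1) by (simp add: is_unit_iff_degree)
next
  fix f g assume fg: "p = f * g"
  have no_linear: "degree h \<noteq> 1" if "h dvd p" for h
  proof
    assume "degree h = 1"
    then obtain c d where h: "h = [:c, d:]" "d \<noteq> 0"
      by (cases h rule: pCons_cases) (auto split: if_splits elim!: degree_eq_zeroE)
    have "poly h (- c / d) = 0" using h by simp
    with \<open>h dvd p\<close> have "poly p (- c / d) = 0" by (auto elim!: dvdE)
    with no_root show False by blast
  qed
  have nz: "f \<noteq> 0" "g \<noteq> 0" using fg assms by auto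
  then have "degree f + degree g = 3"
    using fg assms(1) by (simp add: degree_mult_eq)
  moreover have "degree f \<noteq> 1" "degree g \<noteq> 1"
    using no_linear fg by auto
  ultimately have "degree f = 0 \<or> degree g = 0" by linarith
  then show "f dvd 1 \<or> g dvd 1"
    using nz by (simp add: is_unit_iff_degree)
qed

locale sextic_family =
  fixes k a :: int and P :: "int poly"
  assumes k_ge: "k \<ge> 2"
    and a_eq: "a = - 6 * k - 3"
    and P_eq: "P = monom 1 6 + monom a 5 - monom (2 * a) 4 + monom (2 * a - 3) 3
             - monom (2 * a) 2 + monom a 1 + 1"
begin

section \<open>The sextic and its trace cubic\<close>

lemma P_coeffs: "P = [:1, a, - 2 * a, 2 * a - 3, - 2 * a, a, 1:]"
  unfolding P_eq by (simp add: monom_altdef numeral_eq_Suc one_pCons)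

abbreviation "P_rat \<equiv> map_poly rat_of_int P"

lemma P_rat_coeffs:
  "P_rat = [:1, of_int a, of_int (- 2 * a), of_int (2 * a - 3), of_int (- 2 * a), of_int a, 1:]"
  unfolding P_coeffs by (simp add: map_poly_pCons)

lemma degree_P_rat: "degree P_rat = 6"
  unfolding P_rat_coeffs by simp

lemma lead_coeff_P_rat: "lead_coeff P_rat = 1"
  unfolding P_rat_coeffs by simp

lemma poly_P_rat:
  "poly (map_poly of_rat P_rat) (z::'a::field_char_0) =
     z^6 + of_int a * z^5 - 2 * of_int a * z^4 + (2 * of_int a - 3) * z^3
      - 2 * of_int a * z^2 + of_int a * z + 1"
  unfolding P_rat_coeffs
  by (simp add: map_poly_pCons of_rat_add of_rat_diff of_rat_minus of_rat_mult power_numeral_reduce algebra_simps)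

definition Q :: "rat poly" where
  "Q = [:- 3, of_int (- 2 * a - 3), of_int a, 1:]"

text \<open>The values of \<open>Q\<close>, kept polymorphic so that real and complex arguments
  share the same facts.\<close>

definition trace_fun :: "'a::field_char_0 \<Rightarrow> 'a" where
  "trace_fun w = w^3 + of_int a * w^2 - (2 * of_int a + 3) * w - 3"

lemma poly_Q: "poly (map_poly of_rat Q) (w::'a::field_char_0) = trace_fun w"
  unfolding Q_def trace_fun_def
  by (simp add: map_poly_pCons of_rat_add of_rat_diff of_rat_minus of_rat_mult power_numeral_reduce algebra_simps)

lemma poly_P_rat_eq_trace:
  assumes "z \<noteq> (0::'a::field_char_0)"
  shows "poly (map_poly of_rat P_rat) z = z^3 * trace_fun (z + 1/z)"
  unfolding poly_P_rat trace_fun_def using assms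
  by (simp add: field_simps power_numeral_reduce)

lemma irreducible_Q: "irreducible Q"
proof (rule irreducible_cubic)
  show "degree Q = 3" by (simp add: Q_def)
next
  fix r :: rat
  show "poly Q r \<noteq> 0"
  proof
    assume "poly Q r = 0"
    then have *: "r^3 + of_int a * r^2 - (2 * of_int a + 3) * r - 3 = 0"
      by (simp add: Q_def power_numeral_reduce algebra_simps)
    have "algebraic_int r"
      unfolding algebraic_int_altdef_ipoly
      by (rule exI[of _ "[:- 3, - 2 * a - 3, a, 1:]"])
        (use * in \<open>simp add: map_poly_pCons power_numeral_reduce algebra_simps\<close>)
    moreover have "r \<in> \<rat>" by (metis Rats_of_rat of_rat_eq_id id_apply)
    ultimately have "r \<in> \<int>" by (rule rational_algebraic_int_is_int)
    then obtain n where n: "r = of_int n" by (elim Ints_cases)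
    have "of_int (n^3 + a * n^2 - (2 * a + 3) * n - 3) = (0::rat)"
      using * n by simp
    then have n0: "n^3 + a * n^2 - (2 * a + 3) * n - 3 = 0"
      by (simp only: of_int_eq_0_iff)
    \<comment> \<open>Eisenstein's argument at 3 on an integer zero: all coefficients but the
      leading one are divisible by 3, so 3 divides \<open>n\<close>, and then 9 would divide the
      constant term.\<close>
    have "n ^ 3 = 3 * ((2 * k + 1) * n^2 - (4 * k + 1) * n + 1)"
      using n0 unfolding a_eq by (simp add: algebra_simps)
    then have "3 dvd n ^ 3" by simp
    moreover have "prime (3::int)" by simp
    ultimately have "3 dvd n" using prime_dvd_power by blast
    then obtain m where "n = 3 * m" ..
    with n0 have "3 = 9 * (3 * m^3 + a * m^2 + (4 * k + 1) * m)"
      unfolding a_eq by (simp add: algebra_simps power_numeral_reduce)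
    then have "9 dvd (3::int)" by (metis dvd_triv_left)
    then show False by simp
  qed
qed

section \<open>Zeros of the cubic, location of \<beta> and minimality of the sextic\<close>

text \<open>In this form the values at 0, 2 and \<open>6 * k + 1\<close> are simply
  \<open>w - 3\<close>, which shows the sign changes.\<close>

lemma trace_fun_eq:
  "trace_fun w = (w - (6 * of_int k + 1)) * w * (w - 2) + w - (3::'a::field_char_0)"
  unfolding trace_fun_def by (simp add: a_eq algebra_simps power_numeral_reduce)

lemma trace_roots:
  obtains y1 y2 y3 :: real where
    "0 < y1" "y1 < 1" "1 < y2" "y2 < 2" "2 < y3"
    "trace_fun y1 = 0" "trace_fun y2 = 0" "trace_fun y3 = 0"
proof -
  have cont: "continuous_on S (trace_fun :: real \<Rightarrow> real)" for S
    unfolding trace_fun_def by (intro continuous_intros)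
  have k: "real_of_int k \<ge> 2" using k_ge by linarith
  have v: "trace_fun (0::real) = -3" "trace_fun (1::real) = 6 * k - 2" "trace_fun (2::real) = -1"
      "trace_fun (6 * real_of_int k + 1) = 6 * k - 2"
    unfolding trace_fun_eq by simp_all
  obtain y1 where y1: "0 \<le> y1" "y1 \<le> 1" "trace_fun y1 = (0::real)"
    using IVT'[of trace_fun 0 "0::real" 1] v k cont by auto
  obtain y2 where y2: "1 \<le> y2" "y2 \<le> 2" "trace_fun y2 = (0::real)"
    using IVT2'[of trace_fun "2::real" 0 1] v k cont by auto
  obtain y3 where y3: "2 \<le> y3" "trace_fun y3 = (0::real)"
    using IVT'[of trace_fun 2 "0::real" "6 * k + 1"] v k cont by auto
  have "y1 \<noteq> 0" "y1 \<noteq> 1" "y2 \<noteq> 1" "y2 \<noteq> 2" "y3 \<noteq> 2"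
    using y1 y2 y3 v k by auto
  with y1 y2 y3 show ?thesis by (intro that[of y1 y2 y3]) auto
qed

text \<open>Divided differences: \<open>quad\<close> divides out one difference of zeros,
  \<open>lin\<close> a second one. What remains says that any three distinct zeros sum to
  \<open>- a\<close>, so \<open>y1\<close> and \<open>y2\<close> determine the third.\<close>

lemma trace_roots_complete:
  fixes y1 y2 y3 w :: "'a::field_char_0"
  assumes "trace_fun y1 = 0" "trace_fun y2 = 0" "trace_fun y3 = 0" "trace_fun w = 0"
    "y1 \<noteq> y2" "y1 \<noteq> y3" "y2 \<noteq> y3"
  shows "w = y1 \<or> w = y2 \<or> w = y3"
proof (rule ccontr)
  assume neg: "\<not> ?thesis"
  have quad: "u^2 + u * v + v^2 + of_int a * (u + v) - (2 * of_int a + 3) = 0"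
    if "trace_fun u = 0" "trace_fun v = 0" "u \<noteq> v" for u v :: 'a
  proof -
    have "(u - v) * (u^2 + u * v + v^2 + of_int a * (u + v) - (2 * of_int a + 3))
            = trace_fun u - trace_fun v"
      unfolding trace_fun_def by (simp add: algebra_simps power_numeral_reduce)
    with that show ?thesis by simp
  qed
  have lin: "u + v + t + of_int a = 0"
    if "trace_fun u = 0" "trace_fun v = 0" "trace_fun t = 0" "u \<noteq> v" "u \<noteq> t" "v \<noteq> t" for u v t :: 'a
  proof -
    have "(v - t) * (u + v + t + of_int a) = 0"
      using quad[of u v] quad[of u t] that by algebra
    with that show ?thesis by simp
  qed
  have "y1 + y2 + y3 + of_int a = 0" "y1 + y2 + w + of_int a = 0"
    using lin assms neg by auto
  then have "w = y3" by (metis add_left_imp_eq add_right_imp_eq)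
  with neg show False by simp
qed

text \<open>With \<open>y = \<beta> + 1 / \<beta>\<close>, relation \<open>M\<close> first gives
  \<open>3 < y < 6 * k + 1\<close>, and then a gap \<open>6 * k + 1 - y\<close> below 1/2. As
  \<open>1 / \<beta>\<close> is also below 1/2, \<beta> lies less than 1 below
  \<open>6 * k + 1\<close>.\<close>

lemma root_bounds:
  fixes \<beta> :: real
  assumes "\<beta> > 1" "poly (map_poly of_rat P_rat) \<beta> = 0"
  shows "6 * k < \<beta>" "\<beta> < 6 * k + 1"
proof -
  define y where "y = \<beta> + 1 / \<beta>"
  have k: "real_of_int k \<ge> 2" using k_ge by linarith
  have y2: "y > 2"
  proof -
    have "y - 2 = (\<beta> - 1)^2 / \<beta>"
      unfolding y_def using assms(1) by (simp add: field_simps power2_eq_square)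
    also have "\<dots> > 0" using assms(1) by simp
    finally show ?thesis by simp
  qed
  have "trace_fun y = 0"
    using poly_P_rat_eq_trace[of \<beta>] assms unfolding y_def by simp
  then have M: "(6 * k + 1 - y) * (y * (y - 2)) = y - 3"
    unfolding trace_fun_eq by (simp add: algebra_simps)
  have yy: "y * (y - 2) > 0" using y2 by simp
  have "y < 6 * k + 1"
  proof (rule ccontr)
    assume "\<not> y < 6 * k + 1"
    then have "(6 * k + 1 - y) * (y * (y - 2)) \<le> 0" "y > 3"
      using yy k by (auto intro: mult_nonpos_nonneg)
    with M show False by linarith
  qed
  then have "(6 * k + 1 - y) * (y * (y - 2)) > 0"
    using yy by simp
  with M have y3: "y > 3" by simp
  show "\<beta> < 6 * k + 1"
    using \<open>y < 6 * k + 1\<close> assms(1) unfolding y_def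
    by (smt (verit) divide_pos_pos)
  have "\<beta> > 2" using y3 assms(1) unfolding y_def by (smt (verit) divide_le_eq_1_pos)
  then have b: "1 / \<beta> < 1/2" by (simp add: field_simps)
  have "(6 * k + 1 - y) * y < 1"
  proof -
    have "(6 * k + 1 - y) * y * (y - 2) < 1 * (y - 2)" using M by (simp add: mult.assoc)
    then show ?thesis using y3 by (simp add: mult_less_cancel_right)
  qed
  moreover have "(6 * k + 1 - y) * 3 \<le> (6 * k + 1 - y) * y"
    using y3 \<open>y < 6 * k + 1\<close> by (intro mult_left_mono) auto
  ultimately have "6 * k + 1 - y < 1/2" by argo
  with b show "6 * k < \<beta>" unfolding y_def by linarith
qed

text \<open>If \<open>y = \<beta> + 1/\<beta>\<close>, then every rational polynomial of degree at most 5 vanishing at \<open>\<beta>\<close>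
  becomes, after division by \<open>\<beta>\<^sup>2\<close>, a relation \<open>A(y) \<beta> + B(y) = 0\<close> with \<open>A\<close> and \<open>B\<close> of degree at
  most 2. Then \<open>N = B\<^sup>2 + t A B + A\<^sup>2\<close> vanishes at \<open>y\<close>, hence at its conjugate in \<open>(-2, 2)\<close>, where the
  form is positive definite; so \<open>A\<close> and \<open>B\<close> vanish there and are zero.\<close>

lemma minimal_degree:
  fixes \<beta> :: real and q :: "rat poly"
  assumes "\<beta> > 1" "poly (map_poly of_rat P_rat) \<beta> = 0"
    and q: "q \<noteq> 0" "poly (map_poly of_rat q) \<beta> = 0"
  shows "6 \<le> degree q"
proof (rule ccontr)
  assume deg: "\<not> 6 \<le> degree q"
  define c where "c = coeff q"
  have c_high: "coeff q i = 0" if "i > 5" for i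
    using deg that by (intro coeff_eq_0) auto
  have q_eq: "q = [:c 0, c 1, c 2, c 3, c 4, c 5:]"
  proof (rule poly_eqI)
    fix i
    show "coeff q i = coeff [:c 0, c 1, c 2, c 3, c 4, c 5:] i"
      using c_high[of i] unfolding c_def
      by (auto simp: coeff_pCons eval_nat_numeral split: nat.splits)
  qed
  define A where "A = [:c 3 - c 1 - c 5, c 4 - c 0, c 5:]"
  define B where "B = [:c 2 - c 4 - c 0, c 1 - c 5, c 0:]"
  \<comment> \<open>At \<open>y\<close> this is the product of \<open>A(y) * \<beta> + B(y)\<close>
    and \<open>A(y) / \<beta> + B(y)\<close>, a norm form for the quadratic equation of \<beta> over
    the field of \<open>y\<close>.\<close>
  define N where "N = B * B + [:0, 1:] * A * B + A * A"
  define y where "y = \<beta> + 1 / \<beta>"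
  let ?e = "\<lambda>p. poly (map_poly of_rat p) :: real \<Rightarrow> real"
  have N: "?e N t = (?e B t)^2 + t * ?e A t * ?e B t + (?e A t)^2" for t
    unfolding N_def by (simp add: poly_of_rat power2_eq_square)
  have inv: "\<beta> * (1 / \<beta>) = 1" using assms(1) by simp
  have rel: "?e A y * \<beta> + ?e B y = 0"
  proof -
    have "c0 + b * (c1 + b * (c2 + b * (c3 + b * (c4 + b * c5)))) =
        b^2 * ((c3 - c1 - c5 + (b + i) * (c4 - c0 + (b + i) * c5)) * b
          + (c2 - c4 - c0 + (b + i) * (c1 - c5 + (b + i) * c0)))"
      if "b * i = 1" for b i c0 c1 c2 c3 c4 c5 :: real
      using that by algebra
    from this[OF inv] have "?e q \<beta> = \<beta>^2 * (?e A y * \<beta> + ?e B y)"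
      unfolding q_eq A_def B_def y_def
      by (simp only: poly_of_rat_pCons of_rat_diff map_poly_0 poly_0 mult_zero_right add_0_right)
    with q(2) assms(1) show ?thesis by simp
  qed
  have "?e N y = 0"
  proof -
    have "\<beta>^2 - y * \<beta> + 1 = 0"
      unfolding y_def using inv by (simp add: algebra_simps power2_eq_square)
    then show ?thesis unfolding N using rel by algebra
  qed
  moreover have y0: "?e Q y = 0"
    unfolding poly_Q using poly_P_rat_eq_trace[of \<beta>] assms unfolding y_def by simp
  ultimately have "Q dvd N"
    using irreducible_dvd_of_common_root[OF irreducible_Q] by blast
  obtain t :: real where t: "1 < t" "t < 2" "trace_fun t = 0"
    using trace_roots by metis
  then have "?e N t = 0"
    using \<open>Q dvd N\<close> poly_Q[of t] by (auto elim!: dvdE simp: poly_of_rat)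
  then have sq: "(?e B t + t / 2 * ?e A t)^2 + (1 - t^2 / 4) * (?e A t)^2 = 0"
    unfolding N by (simp add: power2_eq_square algebra_simps)
  have "t^2 < 2^2" using t by (intro power_strict_mono) auto
  then have pos: "1 - t^2 / 4 > 0" by simp
  have "(1 - t^2 / 4) * (?e A t)^2 = 0"
    using sq pos by (smt (verit) zero_le_power2 mult_nonneg_nonneg)
  then have A0: "?e A t = 0" using pos by simp
  then have B0: "?e B t = 0" using sq by simp
  have "Q dvd A" "Q dvd B"
    using irreducible_dvd_of_common_root[OF irreducible_Q] A0 B0 t(3) poly_Q[of t] by metis+
  moreover have "degree A < degree Q" "degree B < degree Q"
    unfolding A_def B_def Q_def by simp_all
  ultimately have "A = 0" "B = 0"
    using dvd_imp_degree_le by (metis leD)+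
  then have "q = 0" unfolding A_def B_def q_eq by auto
  with q(1) show False ..
qed

lemma minimal_P:
  fixes \<beta> :: real
  assumes "\<beta> > 1" "poly (map_poly of_rat P_rat) \<beta> = 0"
  shows "is_minimal_poly P_rat \<beta>"
  unfolding is_minimal_poly_def
  using minimal_degree[OF assms] lead_coeff_P_rat degree_P_rat assms(2) by auto

section \<open>Galois conjugates and the Salem property\<close>

text \<open>The minimal polynomial is unique: the difference of two monic candidates of degree 6
  vanishes at \<beta> and has degree below 6.\<close>

lemma galois_conjugates_eq:
  fixes \<beta> :: real
  assumes "\<beta> > 1" "poly (map_poly of_rat P_rat) \<beta> = 0"
  shows "galois_conjugates \<beta> = {z. poly (map_poly of_rat P_rat) z = 0}"
proof -
  have "p = P_rat" if p: "is_minimal_poly p \<beta>" for p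
  proof (rule ccontr)
    assume ne: "p \<noteq> P_rat"
    have "p \<noteq> 0" using p by (auto simp: is_minimal_poly_def)
    have P0: "P_rat \<noteq> 0" using degree_P_rat by auto
    have "degree p = 6"
      using p minimal_degree[OF assms \<open>p \<noteq> 0\<close>] assms(2) P0 degree_P_rat
      unfolding is_minimal_poly_def by (metis le_antisym)
    have "poly (map_poly of_rat (p - P_rat)) \<beta> = 0"
      using p assms(2) by (simp add: poly_of_rat_diff is_minimal_poly_def)
    then have "6 \<le> degree (p - P_rat)"
      using ne by (intro minimal_degree[OF assms]) auto
    moreover have "degree (p - P_rat) < 6"
    proof (rule degree_lessI)
      show "p - P_rat \<noteq> 0 \<or> 0 < (6::nat)" by simp
      show "\<forall>i\<ge>6. coeff (p - P_rat) i = 0"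
      proof (intro allI impI)
        fix i :: nat assume "6 \<le> i"
        then consider "i = 6" | "i > 6" by linarith
        then show "coeff (p - P_rat) i = 0"
        proof cases
          case 1
          then show ?thesis
            using p \<open>degree p = 6\<close> lead_coeff_P_rat degree_P_rat
            by (simp add: is_minimal_poly_def)
        next
          case 2
          then show ?thesis using \<open>degree p = 6\<close> degree_P_rat by (simp add: coeff_eq_0)
        qed
      qed
    qed
    ultimately show False by simp
  qed
  with minimal_P[OF assms] show ?thesis
    unfolding galois_conjugates_def by blast
qed

text \<open>The equation \<open>z^2 - t * z + 1 = 0\<close> has negative discriminant, so
  \<open>z\<close> is not real. The imaginary part then gives \<open>t = 2 * p\<close>, and the real
  part gives norm 1.\<close>

lemma norm_eq_1_of_trace:
  fixes z :: complex and t :: real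
  assumes "z + 1 / z = of_real t" "z \<noteq> 0" "\<bar>t\<bar> < 2"
  shows "norm z = 1"
proof -
  obtain p q where z: "z = Complex p q" by (cases z)
  have "z^2 - of_real t * z + 1 = 0"
    unfolding assms(1)[symmetric] using assms(2) by (simp add: field_simps power2_eq_square)
  then have re: "p^2 - q^2 - t * p + 1 = 0" and im: "q * (2 * p - t) = 0"
    unfolding z by (simp_all add: complex_eq_iff power2_eq_square algebra_simps)
  have "t^2 < 2^2" using assms(3) abs_square_less_1[of "t/2"] by (simp add: power_divide)
  then have "1 - t^2 / 4 > 0" by simp
  have "q \<noteq> 0"
  proof
    assume "q = 0"
    then have "(p - t / 2)^2 + (1 - t^2 / 4) = 0"
      using re by (simp add: power2_eq_square algebra_simps)
    with \<open>1 - t^2 / 4 > 0\<close> show False by (smt (verit) zero_le_power2)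
  qed
  with im have "t = 2 * p" by simp
  with re have "p^2 + q^2 = 1" by (simp add: power2_eq_square algebra_simps)
  then show ?thesis unfolding z by (simp add: cmod_def)
qed

lemma solve_trace:
  fixes w :: complex
  obtains z where "z \<noteq> 0" "z + 1 / z = w"
proof -
  define s where "s = csqrt (w^2 - 4)"
  define z where "z = (w + s) / 2"
  have s: "s^2 = w^2 - 4" by (simp add: s_def)
  have "z * ((w - s) / 2) = (w^2 - s^2) / 4"
    unfolding z_def by (simp add: field_simps power2_eq_square)
  also have "\<dots> = 1" unfolding s by simp
  finally have 1: "z * ((w - s) / 2) = 1" .
  then have "z \<noteq> 0" by auto
  with 1 have "1 / z = (w - s) / 2" by (simp add: field_simps)
  then have "z + 1 / z = w" unfolding z_def by (simp add: field_simps)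
  with \<open>z \<noteq> 0\<close> show ?thesis by (rule that)
qed

lemma trace_fun_of_real: "trace_fun (of_real t :: complex) = of_real (trace_fun t)"
  unfolding trace_fun_def by simp

lemma salem_number_root:
  fixes \<beta> :: real
  assumes b: "\<beta> > 1" "poly (map_poly of_rat P_rat) \<beta> = 0"
  shows "salem_number \<beta>"
  unfolding salem_number_def
proof (intro conjI)
  show "\<beta> > 1" by fact
  have "map_poly of_rat P_rat = (map_poly of_int P :: real poly)"
    by (simp add: map_poly_map_poly o_def)
  with b(2) show "algebraic_int \<beta>"
    unfolding algebraic_int_altdef_ipoly by (intro exI[of _ P]) (simp add: P_coeffs)
  obtain y1 y2 y3 :: real where y: "0 < y1" "y1 < 1" "1 < y2" "y2 < 2" "2 < y3"
    "trace_fun y1 = 0" "trace_fun y2 = 0" "trace_fun y3 = 0"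
    by (rule trace_roots)
  let ?y = "\<beta> + 1 / \<beta>"
  have ty: "trace_fun ?y = 0" using poly_P_rat_eq_trace[of \<beta>] b by simp
  have "?y - 2 = (\<beta> - 1)^2 / \<beta>"
    using b(1) by (simp add: field_simps power2_eq_square)
  also have "\<dots> > 0" using b(1) by simp
  finally have y2: "?y > 2" by simp
  with trace_roots_complete[of y1 y2 y3 ?y] y ty have y3: "y3 = ?y" by auto
  have unit: "norm z \<le> 1" if z: "poly (map_poly of_rat P_rat) z = 0" "z \<noteq> of_real \<beta>" for z :: complex
  proof -
    have z0: "z \<noteq> 0" using z(1) unfolding poly_P_rat by auto
    then have "trace_fun (z + 1 / z) = 0" using poly_P_rat_eq_trace[of z] z(1) by simp
    then have "z + 1 / z = of_real y1 \<or> z + 1 / z = of_real y2 \<or> z + 1 / z = of_real y3"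
      using y by (intro trace_roots_complete) (auto simp: trace_fun_of_real)
    then show ?thesis
    proof (elim disjE)
      assume "z + 1 / z = of_real y3"
      then have "z + 1 / z = of_real \<beta> + 1 / of_real \<beta>" unfolding y3 by simp
      \<comment> \<open>The trace \<open>y3\<close> belongs only to \<beta> and
        \<open>1 / \<beta>\<close>; the traces \<open>y1\<close> and \<open>y2\<close> lead to the
        unit circle.\<close>
      then have "(z - of_real \<beta>) * (z - 1 / of_real \<beta>) = 0"
        using z0 b(1) by (simp add: field_simps)
      with z(2) have "z = of_real (1 / \<beta>)" by simp
      then have "norm z = 1 / \<beta>" using b(1) by (simp only: norm_of_real) simp
      then show ?thesis using b(1) by simp
    qed (use norm_eq_1_of_trace[of z y1] norm_eq_1_of_trace[of z y2] z0 y in auto)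
  qed
  then show "\<forall>\<alpha>\<in>galois_conjugates \<beta> - {of_real \<beta>}. norm \<alpha> \<le> 1"
    using galois_conjugates_eq[OF b] by auto
  obtain z :: complex where z: "z \<noteq> 0" "z + 1 / z = of_real y1" by (rule solve_trace)
  have "norm z = 1" using norm_eq_1_of_trace[OF z(2,1)] y by simp
  moreover have "poly (map_poly of_rat P_rat) z = 0"
    using poly_P_rat_eq_trace[OF z(1)] z(2) y trace_fun_of_real[of y1] by simp
  moreover have "z \<noteq> of_real \<beta>" using \<open>norm z = 1\<close> b(1) by auto
  ultimately show "\<exists>\<alpha>\<in>galois_conjugates \<beta> - {of_real \<beta>}. norm \<alpha> = 1"
    using galois_conjugates_eq[OF b] by blast
qed

lemma salem_poly_P: "salem_poly P"
proof -
  obtain y :: real where y: "2 < y" "trace_fun y = 0" using trace_roots by metis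
  define s where "s = sqrt (y^2 - 4)"
  define \<beta> where "\<beta> = (y + s) / 2"
  have "y^2 > 2^2" using y by (intro power_strict_mono) auto
  then have s: "s > 0" "s^2 = y^2 - 4" unfolding s_def by simp_all
  have b: "\<beta> > 1" using y s unfolding \<beta>_def by simp
  have "\<beta> * ((y - s) / 2) = (y^2 - s^2) / 4"
    unfolding \<beta>_def by (simp add: field_simps power2_eq_square)
  then have "1 / \<beta> = (y - s) / 2" using b s by (simp add: field_simps)
  then have "\<beta> + 1 / \<beta> = y" unfolding \<beta>_def by (simp add: field_simps)
  then have "poly (map_poly of_rat P_rat) \<beta> = 0"
    using poly_P_rat_eq_trace[of \<beta>] b y by simp
  then show ?thesis
    unfolding salem_poly_def using salem_number_root minimal_P b by blast
qed

end

section \<open>Digit words and greedy expansions\<close>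

text \<open>The remainder after prescribed digits. Without floors it is affine in \<open>r\<close>,
  so that a cycle becomes an algebraic identity; \<open>admissible\<close> later ensures that the
  digits are the greedy ones.\<close>

definition run :: "real \<Rightarrow> real \<Rightarrow> int list \<Rightarrow> real" where
  "run b = foldl (\<lambda>r c. b * r - of_int c)"

lemma run_simps [simp]:
  "run b r [] = r"
  "run b r (c # cs) = run b (b * r - of_int c) cs"
  "run b r (cs @ ds) = run b (run b r cs) ds"
  by (simp_all add: run_def)

lemma run_take_Suc:
  assumes "i < length cs"
  shows "run b r (take (Suc i) cs) = b * run b r (take i cs) - of_int (cs ! i)"
  using assms by (simp add: take_Suc_conv_app_nth)

lemma run_blocks:
  assumes "\<And>i. 1 \<le> i \<Longrightarrow> i \<le> int n \<Longrightarrow> run b (s + of_int (i - 1) * d) (f i) = s + of_int i * d"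
  shows "run b s (concat (map f [1..int n])) = s + of_nat n * d"
  using assms
proof (induction n)
  case (Suc n)
  have "[1..int (Suc n)] = [1..int n] @ [int (Suc n)]"
    by (subst upto_rec2) auto
  then have "run b s (concat (map f [1..int (Suc n)])) = run b (s + real n * d) (f (int (Suc n)))"
    using Suc by simp
  also have "\<dots> = s + real (Suc n) * d"
    using Suc.prems[of "int (Suc n)"] by simp
  finally show ?case .
qed simp

definition admissible :: "real \<Rightarrow> real \<Rightarrow> int list \<Rightarrow> bool" where
  "admissible b r cs \<longleftrightarrow> (\<forall>i\<le>length cs. 0 < run b r (take i cs) \<and> run b r (take i cs) < 1)"

lemma admissible_Nil: "admissible b r [] \<longleftrightarrow> 0 < r \<and> r < 1"
  by (simp add: admissible_def)

lemma admissible_start: "admissible b r cs \<Longrightarrow> 0 < r \<and> r < 1"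
  unfolding admissible_def by force

lemma admissible_Cons:
  "admissible b r (c # cs) \<longleftrightarrow> 0 < r \<and> r < 1 \<and> admissible b (b * r - of_int c) cs"
  unfolding admissible_def by (auto simp: All_less_Suc2 less_Suc_eq_le[symmetric])

lemma run_pos_imp_pos:
  assumes "b > 0" "\<forall>c\<in>set cs. 0 \<le> c" "0 < run b r cs"
  shows "0 < r"
  using assms(2,3)
proof (induction cs arbitrary: r)
  case (Cons c cs)
  then have "0 < b * r - of_int c" by (metis list.set_intros(2) run_simps(2))
  moreover have "0 \<le> real_of_int c" using Cons.prems(1) by simp
  ultimately have "0 < b * r" by linarith
  then show ?case using assms(1) by (simp add: zero_less_mult_iff)
qed simp

text \<open>Reading the expansion backwards, \<open>r = (c + r') / b\<close> lies in the unit interval as soon as the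
  next remainder \<open>r'\<close> does, provided that the digit is small.\<close>

lemma admissible_append:
  assumes "b > 0" "\<forall>c\<in>set cs. 0 \<le> c \<and> of_int c + 1 \<le> b" "admissible b (run b r cs) ds"
  shows "admissible b r (cs @ ds)"
  using assms(2,3)
proof (induction cs arbitrary: r)
  case (Cons c cs)
  then have adm: "admissible b (b * r - of_int c) (cs @ ds)" by simp
  then have "0 < b * r - of_int c" "b * r - of_int c < 1"
    unfolding admissible_def by auto
  moreover have "0 \<le> real_of_int c" "of_int c + 1 \<le> b" using Cons.prems(1) by auto
  ultimately have "b * 0 < b * r" "b * r < b * 1" by linarith+
  then have "0 < r" "r < 1"
    using assms(1) by (simp_all only: mult_less_cancel_left_pos)
  with adm show ?case by (simp add: admissible_Cons)
qed simp

section \<open>From admissible words to greedy expansions\<close>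

lemma greedy_remainder_run:
  assumes "admissible b (greedy_remainder b m) cs" "i \<le> length cs"
  shows "greedy_remainder b (m + i) = run b (greedy_remainder b m) (take i cs)"
  using assms(2)
proof (induction i)
  case (Suc i)
  let ?r = "\<lambda>i. run b (greedy_remainder b m) (take i cs)"
  have "?r (Suc i) = b * ?r i - of_int (cs ! i)"
    using Suc.prems by (intro run_take_Suc) simp
  moreover have "0 < ?r (Suc i)" "?r (Suc i) < 1"
    using assms(1) Suc.prems unfolding admissible_def by auto
  \<comment> \<open>The product exceeds the digit by the next remainder, which lies in (0,
    1).\<close>
  ultimately have "\<lfloor>b * ?r i\<rfloor> = cs ! i" by linarith
  then show ?case using Suc \<open>?r (Suc i) = _\<close> by simp
qed simp

lemma greedy_digit_run:
  assumes "admissible b (greedy_remainder b m) cs" "i < length cs"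
  shows "greedy_digit b (m + i + 1) = cs ! i"
proof -
  let ?r = "\<lambda>i. run b (greedy_remainder b m) (take i cs)"
  have "?r (Suc i) = b * ?r i - of_int (cs ! i)"
    using assms(2) by (intro run_take_Suc)
  moreover have "0 < ?r (Suc i)" "?r (Suc i) < 1"
    using assms unfolding admissible_def by auto
  ultimately have "\<lfloor>b * ?r i\<rfloor> = cs ! i" by linarith
  then show ?thesis
    using greedy_remainder_run[OF assms(1), of i] assms(2) by (simp add: greedy_digit_def)
qed

lemma greedy_remainder_periodic:
  assumes "greedy_remainder b (m + p) = greedy_remainder b m" "n \<ge> m"
  shows "greedy_remainder b (n + p) = greedy_remainder b n"
  using assms(2)
proof (induction n rule: dec_induct)
  case (step n)
  then show ?case by (simp add: add.commute)
qed (rule assms)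

lemma greedy_periodic:
  assumes adm: "admissible b (greedy_remainder b m) cs"
    and cycle: "run b (greedy_remainder b m) cs = greedy_remainder b m" and "cs \<noteq> []"
  shows "greedy_digit b (m + i + 1) = cs ! (i mod length cs)"
    and "greedy_remainder b N \<noteq> 0"
proof -
  let ?L = "length cs"
  have L: "?L > 0" using assms(3) by simp
  have base: "greedy_remainder b (m + ?L) = greedy_remainder b m"
    using greedy_remainder_run[OF adm order_refl] cycle by simp
  have mult: "greedy_remainder b (m + i + j * ?L) = greedy_remainder b (m + i)" for i j
  proof (induction j)
    case (Suc j)
    have "greedy_remainder b ((m + i + j * ?L) + ?L) = greedy_remainder b (m + i + j * ?L)"
      using base by (rule greedy_remainder_periodic) simp
    with Suc show ?case by (simp add: algebra_simps)
  qed simp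
  have red: "greedy_remainder b (m + i) = greedy_remainder b (m + i mod ?L)" for i
    using mult[of "i mod ?L" "i div ?L"] by (simp add: add.assoc)
  show "greedy_digit b (m + i + 1) = cs ! (i mod ?L)"
    using greedy_digit_run[OF adm, of "i mod ?L"] red[of i] L by (simp add: greedy_digit_def)
  have pos: "greedy_remainder b (m + i) \<noteq> 0" for i
  proof -
    have "i mod ?L \<le> ?L" using L by (simp add: less_imp_le)
    then show ?thesis
      using greedy_remainder_run[OF adm] adm unfolding red[of i] admissible_def
      by (metis less_irrefl)
  qed
  \<comment> \<open>A zero remainder persists, so it would also occur at index \<open>m + N\<close>,
    inside the cycle.\<close>
  have "greedy_remainder b (N + j) = 0" if "greedy_remainder b N = 0" for j
    using that by (induction j) simp_all
  with pos[of N] show "greedy_remainder b N \<noteq> 0"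
    by (metis add.commute)
qed

section \<open>The period of the expansion\<close>

context sextic_family
begin

section \<open>The explicit period word and its run\<close>

definition up_block :: "int \<Rightarrow> int list" where
  "up_block j = [6 * j, 6 * j, 6 * j, 6 * j + 3]"

definition down_block :: "int \<Rightarrow> int list" where
  "down_block j = [6 * j, 6 * j, 6 * j, 6 * j - 3]"

text \<open>Split off because all its digits stay below \<open>6 * k\<close>; in
  \<open>period_word\<close> the two digits \<open>6 * k\<close> stand directly before and after it.
  For \<open>k = 2\<close> both block lists are empty.\<close>

definition inner_word :: "int list" where
  "inner_word = [2] @ concat (map up_block [1..int (nat (k - 2))])
     @ [6 * (k - 1), 6 * (k - 1), 6 * (k - 1), 6 * k - 2]
     @ [0, 2, 1, 1, 2, 0, 6 * k - 2]
     @ concat (map (\<lambda>i. down_block (k - i)) [1..int (nat (k - 2))])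
     @ [6, 6, 6, 2]"

definition period_word :: "int list" where
  "period_word = [6 * k - 2, 6 * k] @ inner_word @ [6 * k, 6 * k - 2, 6 * k - 1, 6 * k - 1]"

lemma inner_word_bounds: "c \<in> set inner_word \<Longrightarrow> 0 \<le> c \<and> c < 6 * k"
  using k_ge unfolding inner_word_def up_block_def down_block_def by auto

lemma length_inner_word: "int (length inner_word) = 8 * k"
proof -
  have "length (concat (map f xs)) = 4 * length xs"
    if "\<And>j. length (f j) = 4" for f :: "int \<Rightarrow> int list" and xs
    using that by (induction xs) auto
  then show ?thesis
    using k_ge unfolding inner_word_def
    by (simp add: up_block_def down_block_def)
qed

lemma length_period_word: "int (length period_word) = 8 * k + 6"
  using length_inner_word by (simp add: period_word_def)

text \<open>The constant \<open>D\<close> below is \<open>6/(b - 1)\<close>. Raising every digit by 6 while adding \<open>D\<close> to a remainder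
  changes the next remainder by \<open>D\<close> as well, and the first ascending block maps \<open>r\<close> to \<open>r + D\<close>, so
  the ascending blocks form an arithmetic progression of remainders. The descending blocks start from \<open>X\<close>
  and undo it. The last digits of the two runs, \<open>6 k - 2\<close> and \<open>2\<close>, are one more, respectively one less,
  than the block pattern has them.\<close>

lemma run_period_word:
  fixes b :: real
  assumes "b > 1" "poly (map_poly of_rat P_rat) b = 0"
  shows "run b (b - 6 * k) period_word = b - 6 * k"
proof -
  define K where "K = real_of_int k"
  define D where "D = 6*(b^5 - (6*K+2)*b^4 + (6*K+4)*b^3 - (6*K+5)*b^2 + (6*K+1)*b - 2)"
  \<comment> \<open>The remainder after the opening digits \<open>6 * k - 2, 6 * k, 2\<close>.
    Below, \<open>X\<close> is the one after the middle part, reduced modulo \<open>root\<close> to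
    degree 5.\<close>
  define r where "r = b^4 - 6*K*b^3 - (6*K-2)*b^2 - 6*K*b - 2"
  define X where "X = 6*K*b^5-(6*K+1)^2*b^4+(36*K^2+30*K)*b^3-(36*K^2+24*K+2)*b^2+(36*K^2+12*K)*b-(12*K-2)"
  have root: "b^6 - (6*K+3)*b^5 + 2*(6*K+3)*b^4 - (12*K+9)*b^3 + 2*(6*K+3)*b^2 - (6*K+3)*b + 1 = 0"
    using assms(2) unfolding poly_P_rat a_eq K_def by (simp add: algebra_simps)
  have D: "b * D = D + 6"
    using root D_def by algebra
  have up: "b^4*r - 6*(b^3+b^2+b) - 9 = r + D"
    using root D_def r_def by algebra
  have mid: "b^7*(r+(K-1)*D-1) - 2*b^5 - b^4 - b^3 - 2*b^2 - (6*K-2) = X"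
    using root D_def r_def X_def by algebra
  have down: "b^4*X - 6*(K-1)*(b^3+b^2+b+1) + 3 = X - D"
    using root D_def X_def by algebra
  have fin: "b^4*(X-(K-1)*D+1) - 6*K*b^3 - (6*K-2)*b^2 - (6*K-1)*b - (6*K-1) = b - 6*K"
    using root D_def X_def by algebra
  have n: "real (nat (k - 2)) = K - 2" using k_ge by (simp add: K_def)
  have four: "run b s [c1, c2, c3, c4] = b^4*s - b^3*c1 - b^2*c2 - b*c3 - c4" for s c1 c2 c3 c4
    by (simp add: algebra_simps power_numeral_reduce)
  have s1: "run b (b - 6 * k) [6 * k - 2, 6 * k, 2] = r"
    unfolding r_def K_def by (simp add: algebra_simps power_numeral_reduce)
  \<comment> \<open>The first ascending block shifted \<open>t\<close> times: \<open>t * D\<close>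
    on the remainder absorbs \<open>6 * t\<close> on every digit.\<close>
  have up_j: "b^4*(r + t*D) - b^3*(6*t+6) - b^2*(6*t+6) - b*(6*t+6) - (6*t+9) = r + (t+1)*D" for t
    using up D by algebra
  have s2: "run b r (concat (map up_block [1..int (nat (k - 2))])) = r + (K-2) * D"
    unfolding n[symmetric]
  proof (rule run_blocks)
    fix i
    show "run b (r + of_int (i - 1) * D) (up_block i) = r + of_int i * D"
      unfolding up_block_def four using up_j[of "of_int (i - 1)"] by simp
  qed
  have s3: "run b (r + (K-2) * D) [6 * (k - 1), 6 * (k - 1), 6 * (k - 1), 6 * k - 2] = r + (K-1) * D - 1"
    unfolding four using up_j[of "K - 2"] by (simp add: K_def algebra_simps)
  have s4: "run b (r + (K-1) * D - 1) [0, 2, 1, 1, 2, 0, 6 * k - 2] = X"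
    unfolding mid[symmetric] by (simp add: K_def algebra_simps power_numeral_reduce)
  have down_j: "b^4*(X - t*D) - b^3*(6*(K-1-t)) - b^2*(6*(K-1-t)) - b*(6*(K-1-t)) - (6*(K-1-t)-3) = X - (t+1)*D" for t
    using down D by algebra
  have s5: "run b X (concat (map (\<lambda>i. down_block (k - i)) [1..int (nat (k - 2))])) = X + (K-2) * (- D)"
    unfolding n[symmetric]
  proof (rule run_blocks)
    fix i
    show "run b (X + of_int (i - 1) * (- D)) (down_block (k - i)) = X + of_int i * (- D)"
      unfolding down_block_def four using down_j[of "of_int (i - 1)"] by (simp add: K_def)
  qed
  have s6: "run b (X + (K-2) * (- D)) [6, 6, 6, 2] = X - (K-1) * D + 1"
    unfolding four using down_j[of "K - 2"] by (simp add: K_def algebra_simps)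
  have s7: "run b (X - (K-1) * D + 1) [6 * k, 6 * k - 2, 6 * k - 1, 6 * k - 1] = b - 6 * K"
    unfolding four fin[symmetric] by (simp add: K_def algebra_simps)
  have "period_word = [6 * k - 2, 6 * k, 2] @ concat (map up_block [1..int (nat (k - 2))])
     @ [6 * (k - 1), 6 * (k - 1), 6 * (k - 1), 6 * k - 2] @ [0, 2, 1, 1, 2, 0, 6 * k - 2]
     @ concat (map (\<lambda>i. down_block (k - i)) [1..int (nat (k - 2))]) @ [6, 6, 6, 2]
     @ [6 * k, 6 * k - 2, 6 * k - 1, 6 * k - 1]"
    by (simp add: period_word_def inner_word_def)
  then show ?thesis
    by (simp only: run_simps(3) s1 s2 s3 s4 s5 s6 s7) (simp add: K_def)
qed

text \<open>Backward reading works except at the digits \<open>6 * k\<close>: there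
  \<open>(6 * k + r') / b\<close> is less than 1 only if \<open>r' < b - 6 * k\<close>. Hence the
  remainders \<open>u\<close> and \<open>w\<close> that follow these digits must be compared with
  the starting remainder \<open>x\<close>.\<close>

lemma admissible_period_word:
  fixes b :: real
  assumes "b > 1" "poly (map_poly of_rat P_rat) b = 0"
  shows "admissible b (b - 6 * k) period_word"
proof -
  define x where "x = b - 6 * k"
  have b: "6 * k < b" "b < 6 * k + 1" and k: "real_of_int k \<ge> 2"
    using root_bounds[OF assms] k_ge by auto
  have b0: "b > 0" using assms(1) by simp
  have x: "0 < x" "x < 1" using b unfolding x_def by auto
  have small: "of_int c + 1 \<le> b" if "c < 6 * k" for c
  proof -
    have "c + 1 \<le> 6 * k" using that by simp
    then have "real_of_int (c + 1) \<le> real_of_int (6 * k)" by (simp only: of_int_le_iff)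
    with b(1) show ?thesis by simp
  qed
  let ?tail = "[6 * k - 2, 6 * k - 1, 6 * k - 1]"
  define u where "u = run b x [6 * k - 2, 6 * k]"
  define v where "v = run b u inner_word"
  define w where "w = b * v - 6 * k"
  have run_w: "run b w ?tail = x"
    using run_period_word[OF assms]
    unfolding w_def v_def u_def x_def period_word_def by simp
  have adm_w: "admissible b w ?tail"
  proof -
    have "\<forall>c\<in>set ?tail. 0 \<le> c \<and> of_int c + 1 \<le> b"
      using k_ge by (intro ballI conjI small) auto
    then show ?thesis
      using admissible_append[OF b0, of ?tail w "[]"] run_w x by (simp add: admissible_Nil)
  qed
  have v_pos: "0 < v"
  proof -
    have "0 < w" using adm_w by (simp add: admissible_Cons)
    then have "0 < b * v" unfolding w_def using k by simp
    then show ?thesis using b0 by (simp add: zero_less_mult_iff)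
  qed
  then have u_pos: "0 < u"
    using run_pos_imp_pos[OF b0, of inner_word u] inner_word_bounds unfolding v_def by auto
  \<comment> \<open>Both are followed by the digit \<open>6 * k - 2\<close>. Starting from
    \<open>x\<close> the next digit is \<open>6 * k\<close> with positive remainder, whereas from
    \<open>w\<close> it is only \<open>6 * k - 1\<close> with remainder below 1.\<close>
  have "w < x"
  proof -
    have "b * (b * w - (6 * k - 2)) - (6 * k - 1) < 1"
      using adm_w by (simp add: admissible_Cons)
    moreover have "b * (b * x - (6 * k - 2)) - 6 * k = u"
      unfolding u_def by simp
    ultimately have "b * (b * w - (6 * k - 2)) < b * (b * x - (6 * k - 2))"
      using u_pos by simp
    then show ?thesis using b0 by simp
  qed
  then have "b * v < b * 1" unfolding w_def x_def by simp
  then have "v < 1" using b0 by (simp only: mult_less_cancel_left_pos)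
  with v_pos adm_w have "admissible b v (6 * k # ?tail)"
    by (simp add: admissible_Cons w_def)
  then have adm_u: "admissible b u (inner_word @ 6 * k # ?tail)"
    using inner_word_bounds small unfolding v_def by (intro admissible_append b0) auto
  have r2: "0 < b * x - (6 * k - 2)"
    using run_pos_imp_pos[OF b0, of "[6 * k]" "b * x - (6 * k - 2)"] u_pos k_ge unfolding u_def by simp
  \<comment> \<open>The digit after \<open>u\<close> is 2 and \<open>b > 12\<close>, so
    \<open>u < 1/4\<close>; the digit after \<open>x\<close> is \<open>6 * k - 2\<close>, so
    \<open>x > 1/4\<close>.\<close>
  have "u < x"
  proof -
    obtain cs where "inner_word = 2 # cs" by (simp add: inner_word_def)
    then have "admissible b (b * u - 2) (cs @ 6 * k # ?tail)"
      using adm_u by (simp add: admissible_Cons)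
    then have "b * u - 2 < 1" using admissible_start by blast
    moreover have "12 * u < b * u" using b k u_pos by simp
    ultimately have "u < 1 / 4" by linarith
    have "b * (1 / 4) < b * x" using r2 b k by linarith
    then have "1 / 4 < x" using b0 by simp
    with \<open>u < 1 / 4\<close> show ?thesis by simp
  qed
  have "b * (b * x - (6 * k - 2)) < b * 1"
    using \<open>u < x\<close> unfolding u_def x_def by simp
  then have "b * x - (6 * k - 2) < 1" using b0 by (simp only: mult_less_cancel_left_pos)
  with adm_u r2 x show ?thesis
    unfolding x_def[symmetric] period_word_def u_def by (simp add: admissible_Cons)
qed

lemma expansion:
  fixes b :: real
  assumes b: "b > 1" "poly (map_poly of_rat P_rat) b = 0"
  shows "greedy_digit b 1 = 6 * k"
    and "greedy_digit b (i + 2) = period_word ! (i mod length period_word)"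
    and "greedy_remainder b N \<noteq> 0"
proof -
  have "\<lfloor>b\<rfloor> = 6 * k" using root_bounds[OF b] by linarith
  then show "greedy_digit b 1 = 6 * k" by (simp add: greedy_digit_def)
  have rem: "greedy_remainder b 1 = b - 6 * k"
    using \<open>\<lfloor>b\<rfloor> = 6 * k\<close> by simp
  have "period_word \<noteq> []" by (simp add: period_word_def)
  note per = greedy_periodic[of b 1 period_word, unfolded rem,
    OF admissible_period_word[OF b] run_period_word[OF b] this]
  show "greedy_digit b (i + 2) = period_word ! (i mod length period_word)"
    using per(1)[of i] by simp
  show "greedy_remainder b N \<noteq> 0" by (rule per(2))
qed

section \<open>Minimality of the preperiod and the period\<close>

lemma period_word_nth:
  "period_word ! 0 = 6 * k - 2"
  "period_word ! 1 = 6 * k"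
  "j < length inner_word \<Longrightarrow> period_word ! (j + 2) = inner_word ! j"
  "period_word ! (length inner_word + j + 2) = [6 * k, 6 * k - 2, 6 * k - 1, 6 * k - 1] ! j"
  by (simp_all add: period_word_def nth_append)

lemma period_word_nth_eq_max:
  assumes "i < length period_word" "period_word ! i = 6 * k"
  shows "i = 1 \<or> i = length inner_word + 2"
proof -
  consider "i = 0" | "i = 1" | j where "i = j + 2" "j < length inner_word"
    | j where "i = length inner_word + j + 2" "j < 4"
  proof -
    assume *: "i = 0 \<Longrightarrow> thesis" "i = 1 \<Longrightarrow> thesis"
      "\<And>j. i = j + 2 \<Longrightarrow> j < length inner_word \<Longrightarrow> thesis"
      "\<And>j. i = length inner_word + j + 2 \<Longrightarrow> j < 4 \<Longrightarrow> thesis"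
    have "i < length inner_word + 6" using assms(1) by (simp add: period_word_def)
    then show thesis
      using *(1,2) *(3)[of "i - 2"] *(4)[of "i - 2 - length inner_word"] by linarith
  qed
  then show ?thesis
  proof cases
    case (3 j)
    then have "6 * k \<in> set inner_word"
      using assms(2) period_word_nth(3)[of j] nth_mem[of j inner_word] by simp
    then show ?thesis using inner_word_bounds by blast
  next
    case (4 j)
    then have "j = 0 \<or> j = 1 \<or> j = 2 \<or> j = 3" by linarith
    moreover have "[6 * k, 6 * k - 2, 6 * k - 1, 6 * k - 1] ! j = 6 * k"
      using assms(2) period_word_nth(4)[of j] 4(1) by (simp only:)
    ultimately have "j = 0" by (elim disjE) (simp_all add: numeral_2_eq_2 numeral_3_eq_3)
    with 4(1) show ?thesis by simp
  qed (use assms(2) period_word_nth(1) in simp_all)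
qed

lemma period_lengths:
  fixes b :: real
  assumes b: "b > 1" "poly (map_poly of_rat P_rat) b = 0"
  shows "eventually_periodic (greedy_digit b)"
    and "preperiod_length b = 1"
    and "int (period_length b) = 8 * k + 6"
proof -
  let ?c = "greedy_digit b" and ?L = "length period_word" and ?l = "length inner_word"
  have L: "?L = ?l + 6" by (simp add: period_word_def)
  have l: "?l \<ge> 16" using length_inner_word k_ge by linarith
  have first: "?c (Suc 0) = 6 * k" using expansion(1)[OF b] by simp
  have digit: "?c (i + 2) = period_word ! (i mod ?L)" for i by (rule expansion(2)[OF b])
  have max_digit: "i mod ?L = 1 \<or> i mod ?L = ?l + 2" if "?c (i + 2) = 6 * k" for i
    using that digit[of i] L by (intro period_word_nth_eq_max) auto
  have "?c (1 + 2) = 6 * k" unfolding digit using L period_word_nth(2) by simp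
  moreover have "1 + 2 = (3 :: nat)" by simp
  ultimately have third: "?c 3 = 6 * k" by (simp only:)
  have per: "periodic_from ?c 1 ?L"
    unfolding periodic_from_def
  proof (intro conjI allI impI)
    fix n :: nat assume "1 \<le> n"
    then obtain i where "n = Suc i" by (cases n) auto
    then show "?c (n + 1) = ?c (n + 1 + ?L)"
      using digit[of i] digit[of "i + ?L"] by (simp add: add.assoc)
  qed (simp add: L)
  then show "eventually_periodic ?c" unfolding eventually_periodic_def by blast
  \<comment> \<open>Digits 1 and 3 equal \<open>6 * k\<close>, so pure periodicity would put
    \<open>6 * k\<close> at two word positions that differ by 2 modulo \<open>?L\<close>. The only
    such positions, 1 and \<open>?l + 2\<close>, differ by \<open>?l + 1\<close> or 5.\<close>
  have no0: "\<not> periodic_from ?c 0 p" for p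
  proof
    assume "periodic_from ?c 0 p"
    then have p: "p \<ge> 1" "\<And>n. n \<ge> 1 \<Longrightarrow> ?c (n + 0) = ?c (n + 0 + p)"
      unfolding periodic_from_def by blast+
    have "?c (1 + 0 + p) = 6 * k" "?c (3 + 0 + p) = 6 * k"
      using p(2)[of 1] p(2)[of 3] first third by simp_all
    moreover have "1 + 0 + p = p - 1 + 2" "3 + 0 + p = p + 1 + 2"
      using p(1) by simp_all
    ultimately have "?c (p - 1 + 2) = 6 * k" "?c (p + 1 + 2) = 6 * k"
      by (simp_all only:)
    then have "(p - 1) mod ?L = 1 \<or> (p - 1) mod ?L = ?l + 2"
      "(p + 1) mod ?L = 1 \<or> (p + 1) mod ?L = ?l + 2"
      using max_digit[of "p - 1"] max_digit[of "p + 1"] by blast+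
    moreover have "p + 1 = (p - 1) + 2" using p(1) by simp
    then have "(p + 1) mod ?L = ((p - 1) mod ?L + 2) mod ?L"
      by (simp only: mod_add_left_eq)
    ultimately show False using l unfolding L by auto
  qed
  show pre: "preperiod_length b = 1"
    unfolding preperiod_length_def
  proof (rule Least_equality)
    show "\<exists>p. periodic_from ?c 1 p" using per by blast
    show "1 \<le> m" if "\<exists>p. periodic_from ?c m p" for m
      using that no0 by (cases m) auto
  qed
  have "(LEAST p. periodic_from ?c 1 p) = ?L"
  proof (rule Least_equality)
    show "periodic_from ?c 1 ?L" by (rule per)
    fix p assume "periodic_from ?c 1 p"
    then have p: "p \<ge> 1" "\<And>n. n \<ge> 1 \<Longrightarrow> ?c (n + 1) = ?c (n + 1 + p)"
      unfolding periodic_from_def by blast+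
    show "?L \<le> p"
    proof (rule ccontr)
      assume less: "\<not> ?L \<le> p"
      have "?c (2 + 1 + p) = 6 * k" using p(2)[of 2] third by simp
      moreover have "2 + 1 + p = (1 + p) + 2" by simp
      ultimately have "?c ((1 + p) + 2) = 6 * k" by (simp only:)
      then have "(1 + p) mod ?L = 1 \<or> (1 + p) mod ?L = ?l + 2" by (rule max_digit)
      moreover have "1 + p = ?L \<or> 1 + p < ?L" using less by linarith
      \<comment> \<open>A shorter period must carry the first \<open>6 * k\<close> of the word to
        the second. The digits that follow them, 2 and \<open>6 * k - 2\<close>, then
        disagree.\<close>
      ultimately have p_eq: "p = ?l + 1" using p(1) by auto
      have "?c (3 + 1) = ?c (3 + 1 + p)" by (rule p(2)) simp
      moreover have "3 + 1 = 2 + (2 :: nat)" "3 + 1 + p = (2 + p) + 2" by simp_all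
      ultimately have "?c (2 + 2) = ?c ((2 + p) + 2)" by (simp only:)
      then have "period_word ! 2 = period_word ! (2 + p)"
        unfolding digit using L l p_eq by simp
      moreover have "period_word ! 2 = 2"
        using period_word_nth(3)[of 0] l by (simp add: inner_word_def numeral_2_eq_2)
      moreover have "period_word ! (2 + p) = 6 * k - 2"
        using period_word_nth(4)[of 1] p_eq by (simp add: ac_simps)
      ultimately show False using k_ge by linarith
    qed
  qed
  then show "int (period_length b) = 8 * k + 6"
    unfolding period_length_def pre using expansion(3)[OF b] length_period_word by simp
qed

end

theorem proposition5p1:
  fixes k a :: int and P :: "int poly"
  assumes "k \<ge> 2"
    and "a = - 6 * k - 3"
    and "P = monom 1 6 + monom a 5 - monom (2 * a) 4 + monom (2 * a - 3) 3
             - monom (2 * a) 2 + monom a 1 + 1"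
  shows "salem_poly P \<and>
    (\<forall>\<beta>. \<beta> > 1 \<and> salem_number \<beta> \<and> is_minimal_poly (map_poly of_int P) \<beta> \<longrightarrow>
       eventually_periodic (greedy_digit \<beta>) \<and>
       preperiod_length \<beta> = 1 \<and> int (period_length \<beta>) = 8 * k + 6)"
proof -
  interpret sextic_family k a P using assms by unfold_locales
  show ?thesis
    using salem_poly_P period_lengths unfolding is_minimal_poly_def by blast
qed

end
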